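(* Let $R_4(n)$ be the number of partitions of $n$ with max-rook number $4$. As $n\to\infty$, $$R_4(n)\sim \frac{1}{9}n^3,$$ i.e. $\lim_{n\to\infty} R_4(n)/\left(\tfrac19 n^3\right)=1$.
   Context: A partition $\pi$ of a positive integer $n$ is a non-increasing sequence of positive integers $(\lambda_1,\dots,\lambda_r)$ with sum $n$; $\mathscr{P}(n)$ is the set of all partitions of $n$. The Ferrers board $B_\pi$ of $\pi=(\lambda_1,\dots,\lambda_r)$ is the left-justified array of unit squares with $r$ rows whose $i$-th row from the top has $\lambda_i$ squares. Rooks placed on squares of the board are non-intersecting if no two of them lie in the same row or the same column. The max-rook number $R(\pi)$ is the maximal number of non-intersecting rooks that can be placed in $B_\pi$. For positive integers $n,k$, $R_k(n):=\#\{\pi\in\mathscr{P}(n) : R(\pi)=k\}$. *)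

theory Defs
  imports Complex_Main "HOL-Library.Landau_Symbols"
begin

definition partitions :: "nat \<Rightarrow> nat list set" where
  "partitions n = {p. sorted_wrt (\<ge>) p \<and> (\<forall>x\<in>set p. 0 < x) \<and> sum_list p = n}"

text \<open>A square is a pair (row, column); rows and columns are numbered from 0.\<close>

definition ferrers_board :: "nat list \<Rightarrow> (nat \<times> nat) set" where
  "ferrers_board p = {(i, j). i < length p \<and> j < p ! i}"

definition non_intersecting :: "(nat \<times> nat) set \<Rightarrow> bool" where
  "non_intersecting S \<longleftrightarrow>
     (\<forall>a\<in>S. \<forall>b\<in>S. a \<noteq> b \<longrightarrow> fst a \<noteq> fst b \<and> snd a \<noteq> snd b)"

definition max_rook :: "nat list \<Rightarrow> nat" where
  "max_rook p = Max {card S | S. S \<subseteq> ferrers_board p \<and> non_intersecting S}"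

definition rook_count :: "nat \<Rightarrow> nat \<Rightarrow> nat" where
  "rook_count k n = card {p \<in> partitions n. max_rook p = k}"

text \<open>Finiteness, so that \<^const>\<open>Max\<close> and \<^const>\<open>card\<close> above have their intended values.\<close>

lemma finite_ferrers_board: "finite (ferrers_board p)"
proof -
  have "ferrers_board p = (SIGMA i:{..<length p}. {..<p ! i})"
    by (auto simp: ferrers_board_def)
  then show ?thesis by simp
qed

lemma finite_rook_cards:
  "finite {card S | S. S \<subseteq> ferrers_board p \<and> non_intersecting S}"
  by (rule finite_subset[of _ "card ` Pow (ferrers_board p)"])
     (auto simp: finite_ferrers_board)

lemma rook_cards_nonempty:
  "{card S | S. S \<subseteq> ferrers_board p \<and> non_intersecting S} \<noteq> {}"
proof -
  have "{} \<subseteq> ferrers_board p \<and> non_intersecting {}"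
    by (simp add: non_intersecting_def)
  then show ?thesis by blast
qed

lemma finite_partitions: "finite (partitions n)"
proof -
  have len: "length p \<le> sum_list p" if "\<forall>x\<in>set p. 0 < x" for p :: "nat list"
    using that by (induction p) auto
  have "partitions n \<subseteq> {p. set p \<subseteq> {..n} \<and> length p \<le> n}"
    using len by (auto simp: partitions_def dest: member_le_sum_list)
  then show ?thesis
    by (rule finite_subset) (simp add: finite_lists_length_le)
qed

end

theory Submission
  imports Defs "HOL-Library.More_List" "HOL-Real_Asymp.Real_Asymp"
begin

text \<open>
  For every \<open>k \<ge> 1\<close> the number of partitions of \<open>n\<close> with rook number \<open>k\<close> is asymptotically
  \<open>2\<^sup>k / (k! (k - 1)!) n\<^sup>k\<^sup>-\<^sup>1\<close>; the case \<open>k = 4\<close> gives \<open>n\<^sup>3 / 9\<close>.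

  Write \<open>\<lambda>\<^sub>0 \<ge> \<lambda>\<^sub>1 \<ge> \<dots>\<close> for the parts, padded with zeros. All squares of the board lie in its first \<open>i\<close>
  rows or its first \<open>\<lambda>\<^sub>i\<close> columns, so the rook number is at most \<open>i + \<lambda>\<^sub>i\<close>; conversely the
  antidiagonal of a staircase contained in the board carries non-intersecting rooks. Hence the rook
  number is \<open>k\<close> iff the staircase \<open>(k, k - 1, \<dots>, 1)\<close> fits into the board and \<open>i + \<lambda>\<^sub>i \<le> k\<close> for some
  \<open>i \<le> k\<close> (\<open>max_rook_eq_iff\<close>).

  Fix such an \<open>i\<close>. The partition is an \<open>i \<times> (k - i)\<close> rectangle with at most \<open>i\<close> rows appended on its
  right and parts of size at most \<open>k - i\<close> appended below. Taking successive differences of the upper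
  rows and multiplicities of the lower parts as coordinates, these partitions correspond to
  solutions in natural numbers of a linear equation with the coefficients
  \<open>i, \<dots>, 1, k - i, \<dots>, 1\<close> and right-hand side \<open>n - i (k - i)\<close>. Summing over \<open>i\<close> gives an upper
  bound (\<open>rook_count_le\<close>). Solutions all of whose coordinates exceed \<open>k\<close> always yield partitions
  with rook number \<open>k\<close>, and different \<open>i\<close> yield different ones; as subtracting \<open>k + 1\<close> from all
  coordinates only shifts the right-hand side, this gives a lower bound of the same shape
  (\<open>rook_count_ge\<close>).

  The number of solutions of an equation with \<open>k\<close> positive coefficients, the last of which is
  \<open>1\<close>, is asymptotic to \<open>m\<^sup>k\<^sup>-\<^sup>1\<close> divided by \<open>(k - 1)!\<close> times the product of the coefficients, by
  the explicit estimate \<open>card_solutions_bounds\<close>. The product here is \<open>i! (k - i)!\<close>, and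
  \<open>\<Sum>i\<le>k. 1 / (i! (k - i)!) = 2\<^sup>k / k!\<close> yields the constant.
\<close>

section \<open>The rook number of a Ferrers board\<close>

lemma nth_default_antimono:
  fixes p :: "nat list"
  assumes "sorted_wrt (\<ge>) p" "i \<le> j"
  shows "nth_default 0 p j \<le> nth_default 0 p i"
  using assms sorted_wrt_nth_less[OF assms(1), of i j]
  by (cases "i = j") (auto simp: nth_default_def)

text \<open>
  Non-intersecting rooks number at most \<open>i\<close> in the first \<open>i\<close> rows (they are determined by their row)
  and at most \<open>k - i\<close> in the other rows (they are determined by their column).
\<close>

lemma max_rook_le:
  assumes p: "sorted_wrt (\<ge>) p" and i: "i \<le> k" "nth_default 0 p i \<le> k - i"
  shows "max_rook p \<le> k"
proof -
  have "card S \<le> k" if S: "S \<subseteq> ferrers_board p" "non_intersecting S" for S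
  proof -
    have fin: "finite S"
      using S(1) finite_ferrers_board finite_subset by blast
    define U where "U = {x \<in> S. fst x < i}"
    define V where "V = {x \<in> S. i \<le> fst x}"
    have inj: "inj_on fst S" "inj_on snd S"
      using S(2) by (auto simp: inj_on_def non_intersecting_def)
    have "card U = card (fst ` U)"
      using inj_on_subset[of fst S U] inj by (subst card_image) (auto simp: U_def)
    also have "\<dots> \<le> card {..<i}"
      by (intro card_mono) (auto simp: U_def)
    finally have U: "card U \<le> i" by simp
    have "snd x < k - i" if "x \<in> V" for x
    proof -
      have "x \<in> ferrers_board p" "i \<le> fst x"
        using that S by (auto simp: V_def)
      then have "snd x < nth_default 0 p (fst x)"
        by (auto simp: ferrers_board_def nth_default_def)
      also have "\<dots> \<le> nth_default 0 p i"
        using p \<open>i \<le> fst x\<close> by (rule nth_default_antimono)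
      finally show ?thesis using i by simp
    qed
    then have sub: "snd ` V \<subseteq> {..<k - i}" by auto
    have "card V = card (snd ` V)"
      using inj_on_subset[of snd S V] inj by (subst card_image) (auto simp: V_def)
    also have "\<dots> \<le> card {..<k - i}"
      using sub by (intro card_mono) auto
    finally have V: "card V \<le> k - i" by simp
    have "S = U \<union> V" by (auto simp: U_def V_def)
    then have "card S \<le> card U + card V" using card_Un_le by metis
    then show ?thesis using U V i by linarith
  qed
  then show ?thesis
    unfolding max_rook_def
    using finite_rook_cards[of p] rook_cards_nonempty[of p]
    by (subst Max_le_iff) auto
qed

lemma max_rook_ge:
  assumes "\<And>j. j < k \<Longrightarrow> k - j \<le> nth_default 0 p j"
  shows "k \<le> max_rook p"
proof -
  \<comment> \<open>the antidiagonal of the staircase\<close>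
  define S where "S = (\<lambda>j. (j, k - 1 - j)) ` {..<k}"
  have "card S = k"
    by (auto simp: S_def card_image inj_on_def)
  moreover have "S \<subseteq> ferrers_board p"
  proof
    fix x assume "x \<in> S"
    then obtain j where j: "j < k" "x = (j, k - 1 - j)" by (auto simp: S_def)
    with assms[of j] show "x \<in> ferrers_board p"
      by (auto simp: ferrers_board_def nth_default_def split: if_splits)
  qed
  moreover have "non_intersecting S"
    by (auto simp: S_def non_intersecting_def)
  ultimately show ?thesis
    unfolding max_rook_def by (intro Max_ge finite_rook_cards) auto
qed

lemma max_rook_eq_iff:
  assumes p: "sorted_wrt (\<ge>) p"
  shows "max_rook p = k \<longleftrightarrow>
    (\<forall>j<k. k - j \<le> nth_default 0 p j) \<and> (\<exists>i\<le>k. nth_default 0 p i \<le> k - i)"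
proof
  assume eq: "max_rook p = k"
  show "(\<forall>j<k. k - j \<le> nth_default 0 p j) \<and> (\<exists>i\<le>k. nth_default 0 p i \<le> k - i)"
  proof (intro conjI allI impI)
    fix j assume j: "j < k"
    show "k - j \<le> nth_default 0 p j"
    proof (rule ccontr)
      assume "\<not> k - j \<le> nth_default 0 p j"
      then have "max_rook p \<le> k - 1"
        using j by (intro max_rook_le[OF p, of j]) auto
      then show False using eq j by simp
    qed
  next
    show "\<exists>i\<le>k. nth_default 0 p i \<le> k - i"
    proof (rule ccontr)
      assume neg: "\<not> (\<exists>i\<le>k. nth_default 0 p i \<le> k - i)"
      have "Suc k \<le> max_rook p"
      proof (rule max_rook_ge)
        fix j assume "j < Suc k"
        then have "k - j < nth_default 0 p j" using neg by (meson leI less_Suc_eq_le)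
        then show "Suc k - j \<le> nth_default 0 p j" by linarith
      qed
      then show False using eq by simp
    qed
  qed
next
  assume "(\<forall>j<k. k - j \<le> nth_default 0 p j) \<and> (\<exists>i\<le>k. nth_default 0 p i \<le> k - i)"
  then show "max_rook p = k"
    using max_rook_le[OF p] max_rook_ge by (metis le_antisym)
qed

section \<open>Counting the solutions of a linear equation\<close>

text \<open>
  The linear combination of the entries of \<open>cs\<close> with coefficients \<open>as\<close>. It is used for lists of
  equal length only; otherwise the longer one is truncated.
\<close>

definition lincomb :: "nat list \<Rightarrow> nat list \<Rightarrow> nat" where
  "lincomb as cs = sum_list (map2 (*) as cs)"

lemma lincomb_simps [simp]:
  "lincomb [] cs = 0"
  "lincomb (a # as) (c # cs) = a * c + lincomb as cs"
  by (simp_all add: lincomb_def)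

lemma lincomb_append:
  "length as = length cs \<Longrightarrow> lincomb (as @ bs) (cs @ ds) = lincomb as cs + lincomb bs ds"
  by (simp add: lincomb_def)

lemma lincomb_shift:
  "length as = length cs \<Longrightarrow> lincomb as (map ((+) t) cs) = t * sum_list as + lincomb as cs"
  by (induction as cs rule: list_induct2) (auto simp: algebra_simps)

text \<open>The solutions \<open>cs\<close> in natural numbers of the equation \<open>\<Sum> a\<^sub>i c\<^sub>i = m\<close>.\<close>

definition solutions :: "nat list \<Rightarrow> nat \<Rightarrow> nat list set" where
  "solutions as m = {cs. length cs = length as \<and> lincomb as cs = m}"

text \<open>
  Either the first coordinate vanishes, or it can be decreased by one. This is the functional
  equation \<open>F(x) = G(x) + x\<^sup>a F(x)\<close> of the generating functions.
\<close>

lemma solutions_Cons: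
  "solutions (a # as) m = (#) 0 ` solutions as m \<union>
     (if a \<le> m then (\<lambda>cs. Suc (hd cs) # tl cs) ` solutions (a # as) (m - a) else {})"
  (is "?L = ?R")
proof
  show "?L \<subseteq> ?R"
  proof
    fix x assume x: "x \<in> ?L"
    then obtain c cs where cs: "x = c # cs" "length cs = length as" "a * c + lincomb as cs = m"
      by (auto simp: solutions_def length_Suc_conv)
    show "x \<in> ?R"
    proof (cases c)
      case 0
      then show ?thesis using cs by (auto simp: solutions_def)
    next
      case (Suc c')
      then have "a \<le> m" "c' # cs \<in> solutions (a # as) (m - a)"
        using cs by (auto simp: solutions_def)
      then show ?thesis using cs Suc by (auto intro!: image_eqI[of _ _ "c' # cs"])
    qed
  qed
  show "?R \<subseteq> ?L"
    by (auto simp: solutions_def length_Suc_conv split: if_splits)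
qed

lemma finite_solutions:
  assumes "\<forall>a\<in>set as. 0 < a"
  shows "finite (solutions as m)"
  using assms
proof (induction as arbitrary: m)
  case Nil
  have "solutions [] m \<subseteq> {[]}" by (auto simp: solutions_def)
  then show ?case by (rule finite_subset) simp
next
  case (Cons a as)
  show ?case
  proof (induction m rule: less_induct)
    case (less m)
    have "0 < a" using Cons.prems by simp
    then have "a \<le> m \<Longrightarrow> finite (solutions (a # as) (m - a))"
      by (intro less.IH) simp
    then show ?case
      using Cons by (subst solutions_Cons) auto
  qed
qed

lemma card_solutions_Cons:
  assumes "\<forall>b\<in>set (a # as). 0 < b"
  shows "card (solutions (a # as) m) =
    card (solutions as m) + (if a \<le> m then card (solutions (a # as) (m - a)) else 0)"
proof -
  have inj: "inj_on (\<lambda>cs. Suc (hd cs) # tl cs) (solutions (a # as) (m - a))"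
    by (auto simp: inj_on_def solutions_def length_Suc_conv)
  have fin: "finite (solutions as m)" "finite (solutions (a # as) (m - a))"
    using assms by (auto intro!: finite_solutions)
  show ?thesis
  proof (cases "a \<le> m")
    case True
    then show ?thesis
      using fin inj
      by (subst solutions_Cons) (subst card_Un_disjoint, auto simp: card_image)
  qed (subst solutions_Cons, simp add: card_image)
qed

lemma power_add_ge:
  fixes x a :: nat
  shows "x ^ Suc j + Suc j * a * x ^ j \<le> (x + a) ^ Suc j"
proof (induction j)
  case (Suc j)
  have "x ^ Suc (Suc j) + Suc (Suc j) * a * x ^ Suc j
      \<le> (x + a) * (x ^ Suc j + Suc j * a * x ^ j)"
    by (simp add: algebra_simps)
  also have "\<dots> \<le> (x + a) * (x + a) ^ Suc j"
    using Suc by (rule mult_le_mono2)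
  finally show ?case by simp
qed simp

lemma power_add_le:
  fixes x a :: nat
  shows "(x + a) ^ Suc j \<le> x ^ Suc j + Suc j * a * (x + a) ^ j"
proof (induction j)
  case (Suc j)
  have "(x + a) ^ Suc (Suc j) = (x + a) * (x + a) ^ Suc j" by simp
  also have "\<dots> \<le> (x + a) * (x ^ Suc j + Suc j * a * (x + a) ^ j)"
    using Suc by (rule mult_le_mono2)
  also have "\<dots> = x ^ Suc (Suc j) + a * x ^ Suc j + Suc j * a * (x + a) ^ Suc j"
    by (simp add: algebra_simps)
  also have "\<dots> \<le> x ^ Suc (Suc j) + a * (x + a) ^ Suc j + Suc j * a * (x + a) ^ Suc j"
    using power_mono[of x "x + a" "Suc j"] by (intro add_mono mult_le_mono2) auto
  finally show ?case by (simp add: algebra_simps)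
qed simp

text \<open>
  The induction over the coefficients starts from the equation \<open>c = m\<close> with its single solution. In
  the step for a new coefficient \<open>a\<close>, an induction over \<open>m\<close> in steps of \<open>a\<close> along
  \<open>card_solutions_Cons\<close> compares the increment with that of the power \<open>x\<^sup>j\<^sup>+\<^sup>1\<close>, by the two forms of
  Bernoulli's inequality above.
\<close>

lemma card_solutions_bounds:
  assumes "\<forall>a\<in>set as. 0 < a"
  defines "N \<equiv> \<lambda>m. fact (length as) * prod_list as * card (solutions (as @ [1]) m)"
  shows "m ^ length as \<le> N m \<and> N m \<le> (m + sum_list as) ^ length as"
  using assms(1) unfolding N_def
proof (induction as arbitrary: m)
  case Nil
  have "solutions [1] m = {[m]}" by (auto simp: solutions_def length_Suc_conv)
  then show ?case by simp
next
  case (Cons a as)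
  define j where "j = length as"
  define M where "M = (\<lambda>m. fact j * prod_list as * card (solutions (as @ [1]) m))"
  define N where "N = (\<lambda>m. Suc j * a * (fact j * prod_list as)
     * card (solutions ((a # as) @ [1]) m))"
  have IH: "m ^ j \<le> M m" "M m \<le> (m + sum_list as) ^ j" for m
    using Cons unfolding M_def j_def by auto
  have a: "0 < a" using Cons.prems by simp
  have rec: "N m = Suc j * a * M m + (if a \<le> m then N (m - a) else 0)" for m
  proof -
    have pos: "\<forall>b\<in>set (a # as @ [1]). 0 < b" using Cons.prems by auto
    show ?thesis
      unfolding N_def M_def append_Cons card_solutions_Cons[OF pos, of m]
      by (simp add: algebra_simps)
  qed
  have "m ^ Suc j \<le> N m \<and> N m \<le> (m + (a + sum_list as)) ^ Suc j" for m
  proof (induction m rule: less_induct)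
    case (less m)
    have lo: "Suc j * a * m ^ j \<le> Suc j * a * M m"
      and hi: "Suc j * a * M m \<le> Suc j * a * (m + sum_list as) ^ j"
      using IH by (auto intro: mult_le_mono2)
    have step: "(m + sum_list as) ^ Suc j + Suc j * a * (m + sum_list as) ^ j
        \<le> (m + (a + sum_list as)) ^ Suc j"
      using power_add_ge[of "m + sum_list as" j a] by (simp only: ac_simps)
    show ?case
    proof (cases "a \<le> m")
      case True
      then have IHm: "(m - a) ^ Suc j \<le> N (m - a)" "N (m - a) \<le> (m + sum_list as) ^ Suc j"
        using less[of "m - a"] a by auto
      have N: "N m = N (m - a) + Suc j * a * M m" using rec[of m] True by simp
      have "m ^ Suc j \<le> (m - a) ^ Suc j + Suc j * a * m ^ j"
        using power_add_le[of "m - a" a j] True by simp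
      also have "\<dots> \<le> N m" unfolding N using IHm(1) lo by (rule add_mono)
      finally have "m ^ Suc j \<le> N m" .
      moreover have "N m \<le> (m + (a + sum_list as)) ^ Suc j"
        unfolding N by (rule le_trans[OF add_mono[OF IHm(2) hi] step])
      ultimately show ?thesis ..
    next
      case False
      then have "m \<le> Suc j * a" by (simp add: trans_le_add1)
      then have "m ^ Suc j \<le> Suc j * a * m ^ j" unfolding power_Suc by (rule mult_le_mono1)
      moreover have "N m = Suc j * a * M m" using rec[of m] False by simp
      ultimately show ?thesis
        using lo hi step add_leD2 le_trans by metis
    qed
  qed
  moreover have "N m = fact (length (a # as)) * prod_list (a # as)
      * card (solutions ((a # as) @ [1]) m)"
    by (simp add: N_def j_def algebra_simps)
  ultimately show ?case by (metis j_def length_Cons sum_list.Cons)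
qed

lemma card_solutions_asymp:
  assumes as: "as \<noteq> []" "last as = 1" "\<forall>a\<in>set as. 0 < a"
  shows "(\<lambda>n. real (card (solutions as (n - c))) / real n ^ (length as - 1))
    \<longlonglongrightarrow> 1 / (fact (length as - 1) * real (prod_list as))"
proof -
  define bs where "bs = butlast as"
  have as_eq: "as = bs @ [1]" using as unfolding bs_def by (metis append_butlast_last_id)
  define j where "j = length bs"
  define C where "C = fact j * real (prod_list bs)"
  have bs: "\<forall>a\<in>set bs. 0 < a" using as by (simp add: as_eq)
  then have "0 < prod_list bs" by (induction bs) auto
  then have C: "0 < C" by (simp add: C_def)
  have bounds: "real (m ^ j) \<le> C * real (card (solutions as m))"
    "C * real (card (solutions as m)) \<le> real ((m + sum_list bs) ^ j)" for m
  proof -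
    have "C * real (card (solutions as m))
        = real (fact j * prod_list bs * card (solutions (bs @ [1]) m))"
      by (simp add: C_def as_eq)
    then show "real (m ^ j) \<le> C * real (card (solutions as m))"
      "C * real (card (solutions as m)) \<le> real ((m + sum_list bs) ^ j)"
      using card_solutions_bounds[OF bs, of m] unfolding j_def
      by (simp_all only: of_nat_le_iff)
  qed
  have "(\<lambda>n. C * (real (card (solutions as (n - c))) / real n ^ j)) \<longlonglongrightarrow> 1"
  proof (rule tendsto_sandwich)
    have "(\<lambda>n. (real n - real c) / real n) \<longlonglongrightarrow> 1" by real_asymp
    from tendsto_power[OF this, of j]
    show "(\<lambda>n. ((real n - real c) / real n) ^ j) \<longlonglongrightarrow> 1" by simp
    have "(\<lambda>n. (real n + real (sum_list bs)) / real n) \<longlonglongrightarrow> 1" by real_asymp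
    from tendsto_power[OF this, of j]
    show "(\<lambda>n. ((real n + real (sum_list bs)) / real n) ^ j) \<longlonglongrightarrow> 1" by simp
    show "\<forall>\<^sub>F n in sequentially. ((real n - real c) / real n) ^ j
        \<le> C * (real (card (solutions as (n - c))) / real n ^ j)"
      using eventually_ge_at_top[of c]
    proof eventually_elim
      case (elim n)
      then have "(real n - real c) ^ j \<le> C * real (card (solutions as (n - c)))"
        using bounds(1)[of "n - c"] by (simp add: of_nat_diff)
      then show ?case by (simp add: power_divide divide_right_mono)
    qed
    show "\<forall>\<^sub>F n in sequentially. C * (real (card (solutions as (n - c))) / real n ^ j)
        \<le> ((real n + real (sum_list bs)) / real n) ^ j"
    proof (rule always_eventually, rule allI)
      fix n
      have "C * real (card (solutions as (n - c))) \<le> (real (n - c) + real (sum_list bs)) ^ j"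
        using bounds(2)[of "n - c"] by simp
      also have "\<dots> \<le> (real n + real (sum_list bs)) ^ j"
        by (intro power_mono) auto
      finally show "C * (real (card (solutions as (n - c))) / real n ^ j)
        \<le> ((real n + real (sum_list bs)) / real n) ^ j"
        by (simp add: power_divide divide_right_mono)
    qed
  qed
  from tendsto_mult[OF tendsto_const[of "1 / C"] this]
  have "(\<lambda>n. real (card (solutions as (n - c))) / real n ^ j) \<longlonglongrightarrow> 1 / C"
    using C by simp
  then show ?thesis by (simp add: C_def as_eq j_def)
qed

section \<open>Partitions covered by few rows and columns\<close>

text \<open>The list \<open>[r, r - 1, \<dots>, 1]\<close>.\<close>

definition desc :: "nat \<Rightarrow> nat list" where
  "desc r = rev [1..<Suc r]"

lemma desc_simps [simp]: "desc 0 = []" "desc (Suc r) = Suc r # desc r"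
  by (simp_all add: desc_def)

lemma length_desc [simp]: "length (desc r) = r"
  by (simp add: desc_def)

lemma prod_list_desc: "prod_list (desc r) = fact r"
  by (induction r) auto

text \<open>
  The list of \<open>length ds\<close> rows of length at least \<open>b\<close> whose successive differences, from the bottom
  row upwards, are \<open>ds\<close>: the bottom row exceeds \<open>b\<close> by the first entry of \<open>ds\<close>, the row above it
  exceeds the bottom row by the second entry, and so on.
\<close>

fun high :: "nat \<Rightarrow> nat list \<Rightarrow> nat list" where
  "high b [] = []"
| "high b (d # ds) = high (b + d) ds @ [b + d]"

text \<open>
  The list of parts of size at most \<open>r = length ms\<close> in which \<open>r, r - 1, \<dots>, 1\<close> have the
  multiplicities listed in \<open>ms\<close>.
\<close>

fun low :: "nat list \<Rightarrow> nat list" where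
  "low [] = []"
| "low (m # ms) = replicate m (Suc (length ms)) @ low ms"

lemma length_high [simp]: "length (high b ds) = length ds"
  by (induction b ds rule: high.induct) auto

lemma high_ge: "x \<in> set (high b ds) \<Longrightarrow> b \<le> x"
  by (induction b ds rule: high.induct) force+

lemma high_ge_add:
  "x \<in> set (high b ds) \<Longrightarrow> \<forall>d\<in>set ds. t \<le> d \<Longrightarrow> b + t \<le> x"
  by (cases ds) (auto dest: high_ge)

lemma sorted_high: "sorted_wrt (\<ge>) (high b ds)"
  by (induction b ds rule: high.induct) (auto simp: sorted_wrt_append dest: high_ge)

lemma sum_list_high:
  "sum_list (high b ds) = length ds * b + lincomb (desc (length ds)) ds"
  by (induction b ds rule: high.induct) (auto simp: algebra_simps)

lemma high_inj: "high b ds = high b ds' \<Longrightarrow> ds = ds'"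
proof (induction b ds arbitrary: ds' rule: high.induct)
  case (1 b)
  then show ?case by (cases ds') auto
next
  case (2 b d ds)
  then show ?case by (cases ds') auto
qed

lemma high_surj:
  assumes "sorted_wrt (\<ge>) xs" "\<forall>x\<in>set xs. b \<le> x"
  shows "\<exists>ds. high b ds = xs"
  using assms
proof (induction xs arbitrary: b rule: rev_induct)
  case Nil
  show ?case by (rule exI[of _ "[]"]) simp
next
  case (snoc x xs)
  then obtain ds where "high x ds = xs"
    by (auto simp: sorted_wrt_append) metis
  then show ?case using snoc.prems by (intro exI[of _ "(x - b) # ds"]) simp
qed

lemma low_bounds: "x \<in> set (low ms) \<Longrightarrow> 0 < x \<and> x \<le> length ms"
  by (induction ms) force+

lemma sorted_low: "sorted_wrt (\<ge>) (low ms)"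
proof (induction ms)
  case (Cons m ms)
  have "sorted_wrt (\<ge>) (replicate m (Suc (length ms)))" by (induction m) auto
  then show ?case using Cons by (auto simp: sorted_wrt_append dest: low_bounds)
qed simp

lemma sum_list_low: "sum_list (low ms) = lincomb (desc (length ms)) ms"
  by (induction ms) (auto simp: sum_list_replicate algebra_simps)

lemma low_inj: "length ms = length ms' \<Longrightarrow> low ms = low ms' \<Longrightarrow> ms = ms'"
proof (induction ms ms' rule: list_induct2)
  case (Cons m ms m' ms')
  have count_replicate: "count_list (replicate n x) x = n" for n and x :: nat
    by (induction n) auto
  have count: "count_list (low ns) (Suc (length ns)) = 0" for ns
    using low_bounds[of "Suc (length ns)" ns] by (auto simp: count_list_0_iff)
  have "count_list (low (m # ms)) (Suc (length ms))
      = count_list (low (m' # ms')) (Suc (length ms'))"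
    using Cons by (simp del: low.simps)
  then have "m = m'"
    using count[of ms] count[of ms'] Cons.hyps by (simp add: count_list_append count_replicate)
  then show ?case using Cons by simp
qed simp

text \<open>The multiplicity of the largest admissible part is read off by splitting \<open>ys\<close> after its occurrences.\<close>

lemma low_surj:
  assumes "sorted_wrt (\<ge>) ys" "\<forall>y\<in>set ys. 0 < y \<and> y \<le> r"
  shows "\<exists>ms. length ms = r \<and> low ms = ys"
  using assms
proof (induction r arbitrary: ys)
  case 0
  then show ?case by (cases ys) auto
next
  case (Suc r)
  define us where "us = takeWhile (\<lambda>y. y = Suc r) ys"
  define vs where "vs = dropWhile (\<lambda>y. y = Suc r) ys"
  have ys: "ys = us @ vs" by (simp add: us_def vs_def)
  have us: "us = replicate (length us) (Suc r)"
    by (intro replicate_length_same[symmetric]) (auto simp: us_def dest: set_takeWhileD)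
  have sorted: "sorted_wrt (\<ge>) vs" using Suc.prems ys by (simp add: sorted_wrt_append)
  have "y \<le> r" if "y \<in> set vs" for y
  proof -
    from that obtain v vs' where vs': "vs = v # vs'" by (cases vs) auto
    then have "v \<noteq> Suc r" unfolding vs_def by (simp add: dropWhile_eq_Cons_conv)
    moreover have "v \<le> Suc r" using Suc.prems ys vs' by simp
    ultimately show ?thesis using that sorted vs' by auto
  qed
  then obtain ms where "length ms = r" "low ms = vs"
    using Suc.IH[OF sorted] Suc.prems ys by auto
  then show ?case using ys us by (intro exI[of _ "length us # ms"]) simp
qed

lemma nth_default_low_le: "nth_default 0 (low ms) q \<le> length ms"
  using low_bounds[of "low ms ! q" ms] by (auto simp: nth_default_def)

text \<open>If every part size up to \<open>r\<close> occurs, then the staircase \<open>(r, r - 1, \<dots>, 1)\<close> fits.\<close>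

lemma nth_default_low_ge:
  "\<forall>m\<in>set ms. 0 < m \<Longrightarrow> length ms - q \<le> nth_default 0 (low ms) q"
proof (induction ms arbitrary: q)
  case (Cons m ms)
  then have "length ms - (q - m) \<le> nth_default 0 (low ms) (q - m)" "0 < m" by auto
  moreover have "nth_default 0 (low (m # ms)) q
      = (if q < m then Suc (length ms) else nth_default 0 (low ms) (q - m))"
    by (auto simp: nth_default_def nth_append)
  ultimately show ?case by auto
qed simp

section \<open>Coordinates for partitions with given rook number\<close>

text \<open>
  The size contributed by each coordinate in \<open>assemble k i\<close> below. For \<open>k > 0\<close> the order makes the last
  coefficient \<open>1\<close> for every \<open>i \<le> k\<close>, even if one of the two blocks is empty.
\<close>

definition coefs :: "nat \<Rightarrow> nat \<Rightarrow> nat list" where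
  "coefs k i = desc i @ desc (k - i)"

text \<open>
  The partition with \<open>i\<close> rows of length at least \<open>k - i\<close> above parts of size at most \<open>k - i\<close>, given
  by the differences of the former and the multiplicities of the latter.
\<close>

definition assemble :: "nat \<Rightarrow> nat \<Rightarrow> nat list \<Rightarrow> nat list" where
  "assemble k i cs = high (k - i) (take i cs) @ low (drop i cs)"

lemma length_coefs: "i \<le> k \<Longrightarrow> length (coefs k i) = k"
  by (simp add: coefs_def)

lemma coefs_pos: "\<forall>a\<in>set (coefs k i). 0 < a"
  by (auto simp: coefs_def desc_def)

lemma last_coefs: "0 < k \<Longrightarrow> last (coefs k i) = 1"
  by (auto simp: coefs_def desc_def last_append last_rev hd_append)

lemma prod_list_coefs: "prod_list (coefs k i) = fact i * fact (k - i)"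
  by (simp add: coefs_def prod_list_desc)

lemma sum_list_assemble:
  assumes "i \<le> k" "length cs = k"
  shows "sum_list (assemble k i cs) = i * (k - i) + lincomb (coefs k i) cs"
proof -
  have "lincomb (coefs k i) cs = lincomb (coefs k i) (take i cs @ drop i cs)" by simp
  also have "\<dots> = lincomb (desc i) (take i cs) + lincomb (desc (k - i)) (drop i cs)"
    unfolding coefs_def using assms by (intro lincomb_append) simp
  finally show ?thesis
    using assms by (simp add: assemble_def sum_list_high sum_list_low min_def)
qed

lemma assemble_inj:
  assumes "i \<le> k" "length cs = k" "length cs' = k" "assemble k i cs = assemble k i cs'"
  shows "cs = cs'"
proof -
  have "high (k - i) (take i cs) = high (k - i) (take i cs')" "low (drop i cs) = low (drop i cs')"
    using assms by (auto simp: assemble_def append_eq_append_conv)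
  then have "take i cs = take i cs'" "drop i cs = drop i cs'"
    using assms by (auto intro: high_inj low_inj)
  then show ?thesis by (metis append_take_drop_id)
qed

text \<open>
  The staircase condition guarantees that the partition has at least \<open>k\<close> parts. Without it the upper
  block could have fewer than \<open>i\<close> rows when \<open>i = k\<close>.
\<close>

lemma assemble_surj:
  assumes k: "0 < k" "i \<le> k" and p: "p \<in> partitions n"
    and ge: "\<forall>j<k. k - j \<le> nth_default 0 p j" and le: "nth_default 0 p i \<le> k - i"
  shows "p \<in> assemble k i ` solutions (coefs k i) (n - i * (k - i))"
proof -
  have sorted: "sorted_wrt (\<ge>) p" and pos: "\<forall>x\<in>set p. 0 < x" and sum: "sum_list p = n"
    using p by (auto simp: partitions_def)
  have len: "k \<le> length p"
    using ge[rule_format, of "k - 1"] k by (auto simp: nth_default_def split: if_splits)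
  have sorted': "sorted_wrt (\<ge>) (take i p)" "sorted_wrt (\<ge>) (drop i p)"
    using sorted by (metis append_take_drop_id sorted_wrt_append)+
  have "k - i \<le> x" if x: "x \<in> set (take i p)" for x
  proof -
    obtain j where "j < i" "x = p ! j" using x len k by (auto simp: in_set_conv_nth)
    then show ?thesis using ge[rule_format, of j] len k by (auto simp: nth_default_def)
  qed
  then obtain ds where ds: "high (k - i) ds = take i p"
    using high_surj[OF sorted'(1)] by blast
  have "x \<le> k - i" if x: "x \<in> set (drop i p)" for x
  proof -
    obtain j where "i + j < length p" "x = p ! (i + j)"
      using x by (fastforce simp: in_set_conv_nth less_diff_conv add.commute)
    then show ?thesis
      using nth_default_antimono[OF sorted, of i "i + j"] le by (simp add: nth_default_def)
  qed
  moreover have "\<forall>x\<in>set (drop i p). 0 < x" using pos by (auto dest: in_set_dropD)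
  ultimately obtain ms where ms: "length ms = k - i" "low ms = drop i p"
    using low_surj[OF sorted'(2)] by blast
  have lds: "length ds = i"
    using arg_cong[OF ds, of length] len k by simp
  have "p = assemble k i (ds @ ms)" using ds ms lds by (simp add: assemble_def)
  moreover from this have "ds @ ms \<in> solutions (coefs k i) (n - i * (k - i))"
    using sum sum_list_assemble[of i k "ds @ ms"] lds ms k
    by (auto simp: solutions_def length_coefs)
  ultimately show ?thesis by blast
qed

text \<open>
  The last two facts separate the images for different \<open>i\<close>: the row with index \<open>i\<close> is the first one
  of length at most \<open>k\<close>.
\<close>

lemma assemble_props:
  assumes k: "0 < k" "i \<le> k" and cs: "length cs = k" "\<forall>c\<in>set cs. k < c"
  defines "p \<equiv> assemble k i cs"
  shows "p \<in> partitions (sum_list p)" "max_rook p = k"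
    "nth_default 0 p i \<le> k - i" "\<And>j. j < i \<Longrightarrow> k < nth_default 0 p j"
proof -
  define ds where "ds = take i cs"
  define ms where "ms = drop i cs"
  have p: "p = high (k - i) ds @ low ms" by (simp add: p_def assemble_def ds_def ms_def)
  have len: "length ds = i" "length ms = k - i" using k cs by (auto simp: ds_def ms_def)
  have large: "\<forall>d\<in>set ds. Suc k \<le> d" "\<forall>m\<in>set ms. 0 < m"
    using cs(2) by (force simp: ds_def ms_def Suc_le_eq dest: in_set_takeD in_set_dropD)+
  have high: "k < x" if "x \<in> set (high (k - i) ds)" for x
    using high_ge_add[OF that large(1)] by simp
  have sorted: "sorted_wrt (\<ge>) p"
    using low_bounds[of _ ms] high len
    unfolding p sorted_wrt_append by (fastforce simp: sorted_high sorted_low)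
  have "\<forall>x\<in>set p. 0 < x" using low_bounds[of _ ms] high by (fastforce simp: p)
  with sorted show "p \<in> partitions (sum_list p)" by (simp add: partitions_def)
  show upper: "nth_default 0 p i \<le> k - i"
    using nth_default_low_le[of ms 0] len by (simp add: p nth_default_append)
  show large_rows: "k < nth_default 0 p j" if "j < i" for j
    using that len high[of "high (k - i) ds ! j"] by (simp add: p nth_append nth_default_def)
  have "k - j \<le> nth_default 0 p j" if "j < k" for j
  proof (cases "j < i")
    case True
    then show ?thesis using large_rows[of j] by simp
  next
    case False
    then show ?thesis
      using nth_default_low_ge[OF large(2), of "j - i"] len
      by (simp add: p nth_default_append)
  qed
  with upper k show "max_rook p = k"
    unfolding max_rook_eq_iff[OF sorted] by blast
qed

section \<open>Asymptotics of the number of partitions with given rook number\<close>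

lemma rook_count_le:
  assumes "0 < k"
  shows "rook_count k n \<le> (\<Sum>i\<le>k. card (solutions (coefs k i) (n - i * (k - i))))"
proof -
  have "{p \<in> partitions n. max_rook p = k}
      \<subseteq> (\<Union>i\<le>k. assemble k i ` solutions (coefs k i) (n - i * (k - i)))"
  proof
    fix p assume "p \<in> {p \<in> partitions n. max_rook p = k}"
    then have p: "p \<in> partitions n" "max_rook p = k" by auto
    then have "sorted_wrt (\<ge>) p" by (simp add: partitions_def)
    with p(2) obtain i where "i \<le> k" "nth_default 0 p i \<le> k - i"
      and "\<forall>j<k. k - j \<le> nth_default 0 p j"
      unfolding max_rook_eq_iff[OF \<open>sorted_wrt (\<ge>) p\<close>] by blast
    with assemble_surj[OF assms _ p(1)]
    show "p \<in> (\<Union>i\<le>k. assemble k i ` solutions (coefs k i) (n - i * (k - i)))"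
      by blast
  qed
  then have "rook_count k n
      \<le> card (\<Union>i\<le>k. assemble k i ` solutions (coefs k i) (n - i * (k - i)))"
    unfolding rook_count_def
    by (intro card_mono) (auto intro!: finite_solutions simp: coefs_pos)
  also have "\<dots> \<le> (\<Sum>i\<le>k. card (assemble k i ` solutions (coefs k i) (n - i * (k - i))))"
    by (rule card_UN_le) simp
  also have "\<dots> \<le> (\<Sum>i\<le>k. card (solutions (coefs k i) (n - i * (k - i))))"
    by (intro sum_mono card_image_le finite_solutions coefs_pos)
  finally show ?thesis .
qed

lemma rook_count_ge:
  assumes k: "0 < k"
  defines "C \<equiv> \<lambda>i. i * (k - i) + Suc k * sum_list (coefs k i)"
  assumes n: "\<And>i. i \<le> k \<Longrightarrow> C i \<le> n"
  shows "(\<Sum>i\<le>k. card (solutions (coefs k i) (n - C i))) \<le> rook_count k n"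
proof -
  define f where "f = (\<lambda>i cs. assemble k i (map ((+) (Suc k)) cs))"
  define B where "B = (\<lambda>i. f i ` solutions (coefs k i) (n - C i))"
  have inj: "inj_on (f i) (solutions (coefs k i) (n - C i))" if "i \<le> k" for i
  proof (rule inj_onI)
    fix x y assume "x \<in> solutions (coefs k i) (n - C i)" "y \<in> solutions (coefs k i) (n - C i)"
      and "f i x = f i y"
    then have "map ((+) (Suc k)) x = map ((+) (Suc k)) y"
      using that by - (rule assemble_inj[of i k], simp_all add: solutions_def length_coefs f_def)
    then show "x = y" by (simp add: inj_map_eq_map inj_def)
  qed
  have B: "p \<in> partitions n \<and> max_rook p = k \<and> nth_default 0 p i \<le> k - i
      \<and> (\<forall>j<i. k < nth_default 0 p j)" if i: "i \<le> k" and p: "p \<in> B i" for i p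
  proof -
    from p obtain cs where cs: "cs \<in> solutions (coefs k i) (n - C i)" "p = f i cs"
      by (auto simp: B_def)
    let ?cs = "map ((+) (Suc k)) cs"
    have len: "length cs = length (coefs k i)" "length cs = k"
      using cs i by (auto simp: solutions_def length_coefs)
    have "sum_list p = i * (k - i) + lincomb (coefs k i) ?cs"
      using cs len i by (simp add: f_def sum_list_assemble)
    also have "\<dots> = C i + lincomb (coefs k i) cs"
      using len by (simp add: lincomb_shift C_def del: mult_Suc)
    also have "\<dots> = n" using cs n[OF i] by (simp add: solutions_def)
    finally have "sum_list p = n" .
    moreover have "length ?cs = k" "\<forall>c\<in>set ?cs. k < c" using len by auto
    ultimately show ?thesis
      using assemble_props[OF k i, of ?cs] cs by (auto simp: f_def)
  qed
  have disj: "B i \<inter> B j = {}" if "i < j" "j \<le> k" for i j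
  proof (rule ccontr)
    assume "B i \<inter> B j \<noteq> {}"
    then obtain p where "p \<in> B i" "p \<in> B j" by blast
    then show False using B[of i p] B[of j p] that by fastforce
  qed
  have fin: "finite (B i)" for i
    unfolding B_def by (intro finite_imageI finite_solutions coefs_pos)
  have "(\<Sum>i\<le>k. card (solutions (coefs k i) (n - C i))) = (\<Sum>i\<le>k. card (B i))"
    unfolding B_def using inj by (intro sum.cong) (auto simp: card_image)
  also have "\<dots> = card (\<Union>i\<le>k. B i)"
    using disj fin by (subst card_UN_disjoint) (auto, metis disjoint_iff linorder_neqE_nat)
  also have "\<dots> \<le> rook_count k n"
    unfolding rook_count_def using B finite_partitions[of n] by (intro card_mono) auto
  finally show ?thesis .
qed

text \<open>
  Both bounds are sums of the same form \<open>s c n\<close>, with different shifts \<open>c\<close> that do not affect the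
  limit.
\<close>

theorem rook_count_asymp:
  assumes k: "0 < k"
  shows "(\<lambda>n. real (rook_count k n)) \<sim>[sequentially]
    (\<lambda>n. 2 ^ k / (fact k * fact (k - 1)) * real n ^ (k - 1))"
proof -
  define K :: real where "K = 2 ^ k / (fact k * fact (k - 1))"
  define s where "s = (\<lambda>c n. \<Sum>i\<le>k. real (card (solutions (coefs k i) (n - c i))))"
  have limit: "(\<lambda>n. s c n / real n ^ (k - 1)) \<longlonglongrightarrow> K" for c
  proof -
    have "(\<Sum>i\<le>k. 1 / (fact (k - 1) * real (prod_list (coefs k i)))) =
        (\<Sum>i\<le>k. real (k choose i)) / (fact k * fact (k - 1))"
      unfolding sum_divide_distrib
      by (intro sum.cong) (auto simp: prod_list_coefs binomial_fact)
    also have "\<dots> = K"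
      using choose_row_sum[of k] unfolding K_def of_nat_sum[symmetric] by simp
    finally have K: "(\<Sum>i\<le>k. 1 / (fact (k - 1) * real (prod_list (coefs k i)))) = K" .
    have "(\<lambda>n. \<Sum>i\<le>k. real (card (solutions (coefs k i) (n - c i))) / real n ^ (k - 1))
        \<longlonglongrightarrow> (\<Sum>i\<le>k. 1 / (fact (k - 1) * real (prod_list (coefs k i))))"
    proof (rule tendsto_sum)
      fix i assume "i \<in> {..k}"
      then have len: "length (coefs k i) = k" by (simp add: length_coefs)
      then have "coefs k i \<noteq> []" using k by auto
      from card_solutions_asymp[OF this last_coefs[OF k] coefs_pos, of "c i"]
      show "(\<lambda>n. real (card (solutions (coefs k i) (n - c i))) / real n ^ (k - 1))
        \<longlonglongrightarrow> 1 / (fact (k - 1) * real (prod_list (coefs k i)))"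
        by (simp add: len)
    qed
    then show ?thesis unfolding K by (simp add: s_def sum_divide_distrib)
  qed
  define C where "C = (\<lambda>i. i * (k - i) + Suc k * sum_list (coefs k i))"
  have "(\<lambda>n. real (rook_count k n) / real n ^ (k - 1)) \<longlonglongrightarrow> K"
  proof (rule tendsto_sandwich[OF _ _ limit[of C] limit[of "\<lambda>i. i * (k - i)"]])
    show "\<forall>\<^sub>F n in sequentially.
        s C n / real n ^ (k - 1) \<le> real (rook_count k n) / real n ^ (k - 1)"
      using eventually_ge_at_top[of "\<Sum>i\<le>k. C i"]
    proof eventually_elim
      case (elim n)
      have "C i \<le> n" if "i \<le> k" for i
        using member_le_sum[of i "{..k}" C] that elim by simp
      then have "s C n \<le> real (rook_count k n)"
        using rook_count_ge[OF k, of n] unfolding s_def C_def of_nat_sum[symmetric] of_nat_le_iff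
        by blast
      then show ?case by (rule divide_right_mono) simp
    qed
    show "\<forall>\<^sub>F n in sequentially. real (rook_count k n) / real n ^ (k - 1)
        \<le> s (\<lambda>i. i * (k - i)) n / real n ^ (k - 1)"
      using rook_count_le[OF k] unfolding s_def of_nat_sum[symmetric]
      by (intro always_eventually allI divide_right_mono) (simp_all only: of_nat_le_iff, simp)
  qed
  from tendsto_divide[OF this tendsto_const[of K]]
  have "(\<lambda>n. real (rook_count k n) / (K * real n ^ (k - 1))) \<longlonglongrightarrow> 1"
    by (simp add: K_def field_simps)
  then show ?thesis
    unfolding K_def by (rule asymp_equivI')
qed

theorem corollary4p4:
  "(\<lambda>n. real (rook_count 4 n)) \<sim>[sequentially] (\<lambda>n. 1 / 9 * real n ^ 3)"
  using rook_count_asymp[of 4] by (simp add: fact_numeral)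

end
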